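(* Let $\mathcal X$ be a set, let $D=(\boldsymbol x,\boldsymbol y)\in\mathcal X^n\times\mathbb R^n$ be data with $\boldsymbol y\neq 0$, and let $\mathcal P$ be a class of projective regressors, i.e. of functions $P:\mathcal X^n\to\mathbb R^{n\times n}$ with $P=P^2$. Then the best projective regressor in $\mathcal P$ for the data $D$ (in the sense of the loss rank principle) is $$P^{best}\;=\;\mathop{\arg\max}_{P\in\mathcal P}\ \mathrm{KL}\Big(\frac{\operatorname{tr}P(\boldsymbol x)}{n}\,\Big\|\,\frac{\boldsymbol y^\top P(\boldsymbol x)\boldsymbol y}{\boldsymbol y^\top\boldsymbol y}\Big),\qquad\text{provided}\quad \frac{\operatorname{tr}P(\boldsymbol x)}{n}<\frac{\boldsymbol y^\top P(\boldsymbol x)\boldsymbol y}{\boldsymbol y^\top\boldsymbol y}.$$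
   Context: A projective regressor $P$ predicts, at the training points $\boldsymbol x=(x_1,\dots,x_n)$, the values $\hat{\boldsymbol y}=P(\boldsymbol x)\boldsymbol y$ from $\boldsymbol y=(y_1,\dots,y_n)^\top\in\mathbb R^n$. $\|\cdot\|$ is the Euclidean norm and $\operatorname{tr}$ the trace. Regularized quadratic loss: for $\alpha>0$ and $\boldsymbol y'\in\mathbb R^n$, $$\mathrm{Loss}_P^\alpha(\boldsymbol y'|\boldsymbol x):=\|\boldsymbol y'-P(\boldsymbol x)\boldsymbol y'\|^2+\alpha\|\boldsymbol y'\|^2 .$$ Log loss rank (log loss volume): $$\mathrm{LR}_P^\alpha(\boldsymbol y|\boldsymbol x):=\log\big|V_P^\alpha(L)\big|,\qquad V_P^\alpha(L):=\{\boldsymbol y'\in\mathbb R^n:\mathrm{Loss}_P^\alpha(\boldsymbol y'|\boldsymbol x)\le L\},\qquad L:=\mathrm{Loss}_P^\alpha(\boldsymbol y|\boldsymbol x),$$ where $|\cdot|$ is $n$-dimensional volume. The loss rank principle (LoRP) declares the best regressor in a class to be the one of smallest log loss rank, where the regularization parameter $\alpha$ is also determined by minimizing the log loss rank; so "best" means minimizing $\mathrm{LR}_P^\alpha(\boldsymbol y|\boldsymbol x)$ over both $P\in\mathcal P$ and $\alpha$. Relative entropy (Kullback–Leibler divergence): $$\mathrm{KL}(p\|q)=p\log\frac pq+(1-p)\log\frac{1-p}{1-q}.$$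
   Formalization: The matrices P(x) are additionally assumed symmetric (orthogonal projections) at the training points, since the claim fails for oblique idempotents; the arg max ranges over those P in the class meeting the proviso, at least one of which is assumed to exist. *)

theory Defs
  imports "HOL-Analysis.Analysis"
begin

type_synonym ('a, 'n) regressor = "'a ^ 'n \<Rightarrow> real ^ 'n ^ 'n"

definition projective_regressor :: "('a, 'n::finite) regressor \<Rightarrow> bool" where
  "projective_regressor P \<longleftrightarrow> (\<forall>x. P x ** P x = P x)"

definition reg_loss :: "('a, 'n::finite) regressor \<Rightarrow> 'a ^ 'n \<Rightarrow> real \<Rightarrow> real ^ 'n \<Rightarrow> real" where
  "reg_loss P x \<alpha> y' = (norm (y' - P x *v y'))\<^sup>2 + \<alpha> * (norm y')\<^sup>2"

definition loss_sublevel ::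
  "('a, 'n::finite) regressor \<Rightarrow> 'a ^ 'n \<Rightarrow> real \<Rightarrow> real \<Rightarrow> (real ^ 'n) set" where
  "loss_sublevel P x \<alpha> L = {y'. reg_loss P x \<alpha> y' \<le> L}"

text \<open>For \<open>\<alpha> > 0\<close> and \<open>y \<noteq> 0\<close> the sublevel set is a nondegenerate solid ellipsoid, so its measure
  is positive and finite and the logarithm is the genuine one.\<close>

definition log_loss_rank ::
  "('a, 'n::finite) regressor \<Rightarrow> 'a ^ 'n \<Rightarrow> real \<Rightarrow> real ^ 'n \<Rightarrow> real" where
  "log_loss_rank P x \<alpha> y = ln (measure lebesgue (loss_sublevel P x \<alpha> (reg_loss P x \<alpha> y)))"

text \<open>The minimum over \<open>\<alpha>\<close> is taken as an infimum in the extended reals: if \<open>P x *v y = y\<close> and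
  \<open>P x\<close> is not the identity, the log loss rank tends to \<open>-\<infinity>\<close> as \<open>\<alpha> \<rightarrow> 0\<close>.\<close>

definition min_log_loss_rank ::
  "('a, 'n::finite) regressor \<Rightarrow> 'a ^ 'n \<Rightarrow> real ^ 'n \<Rightarrow> ereal" where
  "min_log_loss_rank P x y = (INF \<alpha>\<in>{0<..}. ereal (log_loss_rank P x \<alpha> y))"

definition lorp_best ::
  "('a, 'n::finite) regressor set \<Rightarrow> 'a ^ 'n \<Rightarrow> real ^ 'n \<Rightarrow> ('a, 'n) regressor \<Rightarrow> bool" where
  "lorp_best \<P> x y = is_arg_min (\<lambda>P. min_log_loss_rank P x y) (\<lambda>P. P \<in> \<P>)"

text \<open>Relative entropy of two Bernoulli distributions, with the usual conventions
  \<open>0 log (0/q) = 0\<close> and \<open>p log (p/0) = \<infinity>\<close> for \<open>p > 0\<close>. The value \<open>\<infinity>\<close> does occur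
  (second argument 1, for a perfect fit).\<close>

definition kl_term :: "real \<Rightarrow> real \<Rightarrow> ereal" where
  "kl_term p q = (if p = 0 then 0 else if q = 0 then \<infinity> else ereal (p * ln (p / q)))"

definition KL :: "real \<Rightarrow> real \<Rightarrow> ereal" where
  "KL p q = kl_term p q + kl_term (1 - p) (1 - q)"

definition trace_ratio :: "('a, 'n::finite) regressor \<Rightarrow> 'a ^ 'n \<Rightarrow> real" where
  "trace_ratio P x = trace (P x) / real CARD('n)"

definition fit_ratio :: "('a, 'n::finite) regressor \<Rightarrow> 'a ^ 'n \<Rightarrow> real ^ 'n \<Rightarrow> real" where
  "fit_ratio P x y = (y \<bullet> (P x *v y)) / (y \<bullet> y)"

end

theory Submission
  imports Defs "HOL-Real_Asymp.Real_Asymp"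
begin

text \<open>Let \<open>p\<close> and \<open>q\<close> be the trace ratio and the fit ratio, and \<open>n\<close> the dimension. The loss sublevel
  set is the image of a ball under \<open>I + c P\<close>, and \<open>det (I + (exp t - 1) P) = exp (t tr P)\<close>: the
  left-hand side is a homomorphism in \<open>t\<close> with derivative \<open>tr P\<close> at \<open>0\<close>. Hence, up to a constant
  independent of \<open>P\<close> and \<open>\<alpha>\<close>, the log loss rank is \<open>- n/2\<close> times
  \<open>p ln a + (1 - p) ln b\<close>, where \<open>a = \<alpha> / (1 - q + \<alpha>)\<close> and \<open>b = (1 + \<alpha>) / (1 - q + \<alpha>)\<close> satisfy
  \<open>q a + (1 - q) b = 1\<close>. Gibbs' inequality for the distributions \<open>(p, 1 - p)\<close> and
  \<open>(q a, (1 - q) b)\<close> bounds this by \<open>KL p q\<close>. Equality means \<open>q a = p\<close>, that is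
  \<open>\<alpha> = p (1 - q) / (q - p)\<close>, which is positive if \<open>p < q < 1\<close>; if \<open>q = 1\<close> both sides are
  infinite as \<open>\<alpha> \<rightarrow> 0\<close>. If \<open>p \<ge> q\<close> the supremum is \<open>0\<close>, approached as \<open>\<alpha> \<rightarrow> \<infinity>\<close>. Since \<open>KL p q > 0\<close>
  for \<open>p < q\<close>, regressors with \<open>p \<ge> q\<close> are never best once one with \<open>p < q\<close> is available.\<close>

section \<open>The determinant of \<open>mat 1 + c *\<^sub>R P\<close> for idempotent
  \<open>P\<close>\<close>

text \<open>Jacobi's formula at the identity: the Leibniz expansion is differentiated term by term,
  and only the diagonal product, the term of \<open>id\<close>, contributes.\<close>

lemma DERIV_det_mat_1:
  fixes A :: "real ^ 'n ^ 'n"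
  shows "((\<lambda>s. det (mat 1 + s *\<^sub>R A)) has_real_derivative trace A) (at 0)"
proof -
  \<comment> \<open>The form in which the product rule delivers the derivative; \<open>0 * A\<close>
    is \<open>s * A\<close> evaluated at \<open>s = 0\<close>.\<close>
  let ?d = "\<lambda>\<sigma>. of_int (sign \<sigma>) *
    (\<Sum>i\<in>UNIV. A $ i $ \<sigma> i * (\<Prod>j\<in>UNIV - {i}. mat 1 $ j $ \<sigma> j + 0 * A $ j $ \<sigma> j))"
  \<comment> \<open>a permutation other than \<open>id\<close> moves at least two points, so its term vanishes to second order\<close>
  have zero: "?d \<sigma> = 0" if "\<sigma> permutes UNIV" "\<sigma> \<noteq> id" for \<sigma> :: "'n \<Rightarrow> 'n"
  proof -
    have "(\<Prod>j\<in>UNIV - {i}. (mat 1 :: real ^ 'n ^ 'n) $ j $ \<sigma> j) = 0" for i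
    proof -
      obtain k where k: "\<sigma> k \<noteq> k" using \<open>\<sigma> \<noteq> id\<close> by (metis eq_id_iff)
      then have "\<sigma> (\<sigma> k) \<noteq> \<sigma> k" using permutes_inj[OF that(1)] by (simp add: inj_eq)
      with k obtain j where "j \<noteq> i" "\<sigma> j \<noteq> j" by metis
      then show ?thesis by (intro prod_zero) (auto simp: mat_def intro!: bexI[of _ j])
    qed
    then show ?thesis by (simp del: prod_zero_iff)
  qed
  have "((\<lambda>s. \<Sum>\<sigma> | \<sigma> permutes UNIV. of_int (sign \<sigma>) *
      (\<Prod>i\<in>UNIV. mat 1 $ i $ \<sigma> i + s * A $ i $ \<sigma> i))
      has_real_derivative (\<Sum>\<sigma> | \<sigma> permutes UNIV. ?d \<sigma>)) (at 0)"
    by (intro DERIV_sum DERIV_cmult has_field_derivative_prod) (auto intro!: derivative_eq_intros)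
  moreover have "(\<Sum>\<sigma> | \<sigma> permutes UNIV. ?d \<sigma>) = (\<Sum>\<sigma>\<in>{id}. ?d \<sigma>)"
    by (rule sum.mono_neutral_right) (use zero in \<open>auto simp: permutes_id simp del: add_0_right mult_zero_left\<close>)
  moreover have "(\<Sum>\<sigma>\<in>{id}. ?d \<sigma>) = trace A"
    by (simp add: mat_def trace_def sign_id)
  ultimately show ?thesis by (simp add: det_def)
qed

text \<open>\<open>mat 1 + (a - 1) *\<^sub>R P\<close> scales the range of \<open>P\<close> by
  \<open>a\<close> and fixes its kernel, so the factors multiply.\<close>

lemma mult_mat_1_add_scaleR_idempotent:
  fixes P :: "real ^ 'n ^ 'n"
  assumes "P ** P = P"
  shows "(mat 1 + (a - 1) *\<^sub>R P) ** (mat 1 + (b - 1) *\<^sub>R P) = mat 1 + (a * b - 1) *\<^sub>R P"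
proof -
  have "P *v (P *v v) = P *v v" for v
    by (simp add: matrix_vector_mul_assoc assms)
  then show ?thesis
    unfolding matrix_eq
    by (simp add: matrix_vector_mult_add_rdistrib matrix_vector_right_distrib
        matrix_vector_mult_scaleR algebra_simps
        flip: matrix_vector_mul_assoc scaleR_matrix_vector_assoc)
qed

text \<open>Additivity carries the derivative at 0 to every point, giving
  \<open>h' = trace P * h\<close>; the integrating factor \<open>exp (- t * trace P)\<close> solves
  this without diagonalizing \<open>P\<close>.\<close>

lemma det_mat_1_add_scaleR_idempotent:
  fixes P :: "real ^ 'n ^ 'n"
  assumes "P ** P = P"
  shows "det (mat 1 + (exp t - 1) *\<^sub>R P) = exp (t * trace P)"
proof -
  define h where "h t = det (mat 1 + (exp t - 1) *\<^sub>R P)" for t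
  have h_add: "h (s + t) = h s * h t" for s t
    unfolding h_def
    by (simp add: exp_add assms flip: det_mul mult_mat_1_add_scaleR_idempotent)
  have h_0: "(h has_real_derivative trace P) (at 0)"
  proof -
    have "((\<lambda>s. det (mat 1 + s *\<^sub>R P)) has_real_derivative trace P) (at (exp 0 - 1))"
      using DERIV_det_mat_1[of P] by simp
    moreover have "((\<lambda>t. exp t - 1) has_real_derivative 1) (at (0::real))"
      by (auto intro!: derivative_eq_intros)
    ultimately show ?thesis
      using DERIV_chain2 unfolding h_def by fastforce
  qed
  have h: "(h has_real_derivative trace P * h s) (at s)" for s
  proof -
    have "((\<lambda>t. h (t + - s)) has_real_derivative trace P) (at s)"
      using DERIV_shift[of h "trace P" s "- s"] h_0 by simp
    then have "((\<lambda>t. h (t + - s) * h s) has_real_derivative trace P * h s) (at s)"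
      by (rule DERIV_cmult_right)
    then show ?thesis by (simp flip: h_add)
  qed
  have "((\<lambda>t. h t * exp (- t * trace P)) has_real_derivative 0) (at s)" for s
    by (rule derivative_eq_intros h refl | simp)+
  then have "h t * exp (- t * trace P) = h 0 * exp (- 0 * trace P)"
    using DERIV_isconst_all by blast
  then show ?thesis
    by (simp add: h_def exp_minus field_simps)
qed

section \<open>Symmetric idempotents as orthogonal projections\<close>

lemma inner_symmetric_matrix:
  fixes P :: "real ^ 'n ^ 'n"
  assumes "transpose P = P"
  shows "(P *v x) \<bullet> y = x \<bullet> (P *v y)"
  using assms by (metis dot_lmul_matrix transpose_matrix_vector)

lemma inner_projection_self:
  fixes P :: "real ^ 'n ^ 'n"
  assumes "P ** P = P" "transpose P = P"
  shows "x \<bullet> (P *v x) = (norm (P *v x))\<^sup>2"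
  by (metis assms inner_symmetric_matrix matrix_vector_mul_assoc power2_norm_eq_inner)

text \<open>Pythagoras: \<open>x - P *v x\<close> is orthogonal to \<open>P *v x\<close>.\<close>

lemma norm_sq_sub_projection:
  fixes P :: "real ^ 'n ^ 'n"
  assumes "P ** P = P" "transpose P = P"
  shows "(norm (x - P *v x))\<^sup>2 = (norm x)\<^sup>2 - (norm (P *v x))\<^sup>2"
  by (simp add: power2_norm_eq_inner inner_diff inner_commute
      inner_projection_self[OF assms] inner_projection_self[OF assms, unfolded power2_norm_eq_inner])

text \<open>Symmetry turns \<open>trace (P ** P)\<close> into the squared Frobenius norm, so the
  sign of the trace and the case of trace 0 can be read off.\<close>

lemma trace_projection_eq:
  fixes P :: "real ^ 'n ^ 'n"
  assumes "P ** P = P" "transpose P = P"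
  shows "trace P = (\<Sum>i\<in>UNIV. \<Sum>j\<in>UNIV. (P $ i $ j)\<^sup>2)"
proof -
  have "P $ j $ i = P $ i $ j" for i j
    using assms(2) by (metis transpose_def vec_lambda_beta)
  moreover have "trace (P ** P) = (\<Sum>i\<in>UNIV. \<Sum>j\<in>UNIV. P $ i $ j * P $ j $ i)"
    by (simp add: trace_def matrix_matrix_mult_def)
  ultimately show ?thesis using assms(1) by (simp add: power2_eq_square)
qed

lemma trace_projection_nonneg:
  fixes P :: "real ^ 'n ^ 'n"
  assumes "P ** P = P" "transpose P = P"
  shows "0 \<le> trace P"
  unfolding trace_projection_eq[OF assms] by (intro sum_nonneg) simp

lemma trace_projection_eq_0_imp:
  fixes P :: "real ^ 'n ^ 'n"
  assumes "P ** P = P" "transpose P = P" "trace P = 0"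
  shows "P = 0"
  using assms(3) unfolding trace_projection_eq[OF assms(1,2)]
  by (simp add: sum_nonneg_eq_0_iff sum_nonneg vec_eq_iff)

section \<open>Lebesgue measure of linear images\<close>

lemma measure_shear_cbox:
  fixes a b :: "real ^ 'n"
  assumes "m \<noteq> n"
  shows "measure lebesgue ((\<lambda>x. \<chi> i. if i = m then x $ m + x $ n else x $ i) ` cbox a b) =
    measure lebesgue (cbox a b)" (is "measure lebesgue (?T ` _) = _")
proof (cases "cbox a b = {}")
  case False
  then have "cbox 0 (b - a) \<noteq> {}"
    by (simp add: interval_ne_empty_cart)
  \<comment> \<open>By linearity of the shear, translating the box only translates its image; with
    lower corner 0 it has the form to which \<open>measure_shear_interval\<close> applies.\<close>
  have "?T ` cbox a b = ?T ` (+) a ` cbox 0 (b - a)"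
    by (simp flip: cbox_translation)
  also have "\<dots> = (+) (?T a) ` ?T ` cbox 0 (b - a)"
    unfolding image_image by (intro image_cong) (auto simp: vec_eq_iff)
  finally have "measure lebesgue (?T ` cbox a b) = measure lebesgue (?T ` cbox 0 (b - a))"
    by (simp add: measure_translation)
  also have "\<dots> = measure lebesgue (cbox 0 (b - a))"
    by (rule measure_shear_interval) (use assms \<open>cbox 0 (b - a) \<noteq> {}\<close> in auto)
  also have "\<dots> = measure lebesgue ((+) a ` cbox 0 (b - a))"
    by (simp add: measure_translation)
  finally show ?thesis by (simp flip: cbox_translation)
qed simp

text \<open>The matrix arises from the identity by adding row \<open>n\<close> to row
  \<open>m\<close>.\<close>

lemma det_shear:
  fixes m n :: "'n::finite"
  assumes "m \<noteq> n"
  shows "det (matrix (\<lambda>x :: real ^ 'n. \<chi> i. if i = m then x $ m + x $ n else x $ i)) = 1"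
proof -
  have "matrix (\<lambda>x :: real ^ 'n. \<chi> i. if i = m then x $ m + x $ n else x $ i) =
      (\<chi> k. if k = m then row m (mat 1) + 1 *s row n (mat 1) else row k (mat 1))"
    by (auto simp: matrix_def row_def vec_eq_iff mat_def axis_def)
  then show ?thesis using det_row_operation[OF assms, of "mat 1" 1] by simp
qed

lemma measure_transpose_cbox:
  fixes a b :: "real ^ 'n"
  shows "measure lebesgue ((\<lambda>x. \<chi> i. x $ Transposition.transpose m n i) ` cbox a b) =
    measure lebesgue (cbox a b)" (is "measure lebesgue (?T ` _) = _")
proof (cases "cbox a b = {}")
  case False
  have TT: "?T (?T x) = x" for x :: "real ^ 'n" by (simp add: vec_eq_iff)
  have mem: "?T x \<in> cbox (?T a) (?T b)" if "x \<in> cbox a b" for x and a b :: "real ^ 'n"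
    using that by (simp add: mem_box_cart)
  have image: "?T ` cbox a b = cbox (?T a) (?T b)"
  proof (intro antisym subsetI)
    fix y assume "y \<in> cbox (?T a) (?T b)"
    then have "?T y \<in> cbox a b" using mem[of y "?T a" "?T b"] by (simp only: TT)
    then show "y \<in> ?T ` cbox a b" by (metis TT imageI)
  qed (use mem in auto)
  have "(\<Prod>i\<in>UNIV. ?T b $ i - ?T a $ i) = (\<Prod>i\<in>UNIV. b $ i - a $ i)"
    by (simp, rule prod.reindex_bij_betw[of "Transposition.transpose m n" _ _ "\<lambda>i. b $ i - a $ i"]) simp
  moreover have "cbox (?T a) (?T b) \<noteq> {}" using False image by (metis image_is_empty)
  ultimately show ?thesis using False unfolding image by (simp add: content_cbox_cart)
qed simp

text \<open>The absolute value absorbs the sign of the swap, which is -1 unless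
  \<open>m = n\<close>.\<close>

lemma det_transpose_coords:
  fixes m n :: "'n::finite"
  shows "\<bar>det (matrix (\<lambda>x :: real ^ 'n. \<chi> i. x $ Transposition.transpose m n i))\<bar> = 1"
proof -
  have "matrix (\<lambda>x :: real ^ 'n. \<chi> i. x $ Transposition.transpose m n i) =
      (\<chi> i. mat 1 $ Transposition.transpose m n i)"
    by (auto simp: matrix_def vec_eq_iff mat_def axis_def)
  then show ?thesis
    by (simp add: det_permute_rows permutes_swap_id abs_mult sign_swap_id)
qed

lemma measure_preserving_linear_image:
  fixes f :: "'a::euclidean_space \<Rightarrow> 'a"
  assumes "linear f" "\<And>a b. measure lebesgue (f ` cbox a b) = measure lebesgue (cbox a b)"
  shows "\<forall>S\<in>lmeasurable. f ` S \<in> lmeasurable \<and> measure lebesgue (f ` S) = measure lebesgue S"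
proof
  fix S :: "'a set" assume "S \<in> lmeasurable"
  then have "f ` S \<in> lmeasurable \<and> 1 * measure lebesgue S = measure lebesgue (f ` S)"
    using assms by (intro measure_linear_sufficient) simp_all
  then show "f ` S \<in> lmeasurable \<and> measure lebesgue (f ` S) = measure lebesgue S"
    by simp
qed

text \<open>The library version \<open>measure_linear_image\<close> needs a well-ordered index type.\<close>

lemma measure_linear_image_finite:
  fixes f :: "real ^ 'n \<Rightarrow> real ^ 'n"
  assumes "linear f" "S \<in> lmeasurable"
  shows "measure lebesgue (f ` S) = \<bar>det (matrix f)\<bar> * measure lebesgue S"
proof -
  have "\<forall>S\<in>lmeasurable. f ` S \<in> lmeasurable \<and>
      measure lebesgue (f ` S) = \<bar>det (matrix f)\<bar> * measure lebesgue S"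
  \<comment> \<open>The cases are compositions, maps with a vanishing coordinate, diagonal scalings,
    coordinate swaps and shears.\<close>
  proof (induction rule: induct_linear_elementary[OF assms(1)])
    case (1 f g)
    show ?case
    proof
      fix S :: "(real ^ 'n) set" assume "S \<in> lmeasurable"
      note gS = 1(4)[rule_format, OF this]
      note fgS = 1(3)[rule_format, OF gS[THEN conjunct1]]
      have "\<bar>det (matrix (f \<circ> g))\<bar> = \<bar>det (matrix f)\<bar> * \<bar>det (matrix g)\<bar>"
        by (simp only: matrix_compose[OF 1(2,1)] det_mul abs_mult)
      with gS fgS show "(f \<circ> g) ` S \<in> lmeasurable \<and>
          measure lebesgue ((f \<circ> g) ` S) = \<bar>det (matrix (f \<circ> g))\<bar> * measure lebesgue S"
        by (simp only: image_comp[symmetric] mult.assoc)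
    qed
  next
    case (2 f i)
    \<comment> \<open>The image lies in a coordinate hyperplane, so \<open>f\<close> is not
      surjective and hence not injective: determinant and measure both vanish.\<close>
    have "f x \<noteq> axis i 1" for x
      using 2(2)[of x] by (metis axis_nth zero_neq_one)
    then have "\<not> inj f"
      using linear_injective_imp_surjective[OF 2(1)] by (metis surjD)
    then have "det (matrix f) = 0"
      using det_nz_iff_inj[OF 2(1)] by blast
    moreover have "f ` S \<in> lmeasurable \<and> measure lebesgue (f ` S) = 0" for S
      using negligible_linear_singular_image[OF 2(1) \<open>\<not> inj f\<close>, of S]
      unfolding negligible_iff_measure .
    ultimately show ?case by simp
  next
    case (3 c)
    show ?case
      by (simp add: measurable_stretch measure_stretch) (simp add: matrix_def det_diagonal axis_def)
  next
    case (4 m n)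
    have "linear (\<lambda>x :: real ^ 'n. \<chi> i. x $ Transposition.transpose m n i)"
      by (rule linearI) (simp_all add: vec_eq_iff)
    from measure_preserving_linear_image[OF this measure_transpose_cbox] show ?case
      by (simp only: det_transpose_coords mult_1 simp_thms)
  next
    case (5 m n)
    have "linear (\<lambda>x :: real ^ 'n. \<chi> i. if i = m then x $ m + x $ n else x $ i)"
      by (rule linearI) (simp_all add: vec_eq_iff distrib_left)
    from measure_preserving_linear_image[OF this measure_shear_cbox[OF 5]] show ?case
      by (simp only: det_shear[OF 5] abs_one mult_1 simp_thms)
  qed
  from this[rule_format, OF assms(2)] show ?thesis by (rule conjunct2)
qed

section \<open>The loss ellipsoid and its volume\<close>

text \<open>The loss weights the squared norm by \<open>1 + \<alpha>\<close> on the kernel of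
  \<open>P x\<close> and by \<open>\<alpha>\<close> on its range. Stretching the range by
  \<open>sqrt ((1 + \<alpha>) / \<alpha>)\<close> equalizes the weights, so the loss becomes
  \<open>1 + \<alpha>\<close> times the squared norm.\<close>

lemma loss_sublevel_eq_image:
  fixes P :: "('a, 'n::finite) regressor"
  assumes P: "P x ** P x = P x" "transpose (P x) = P x" and "\<alpha> > 0" "L \<ge> 0"
  shows "loss_sublevel P x \<alpha> L =
    (*v) (mat 1 + (sqrt ((1 + \<alpha>) / \<alpha>) - 1) *\<^sub>R P x) ` cball 0 (sqrt (L / (1 + \<alpha>)))"
proof -
  define b where "b = sqrt ((1 + \<alpha>) / \<alpha>)"
  have "b > 0" "b\<^sup>2 = (1 + \<alpha>) / \<alpha>" using \<open>\<alpha> > 0\<close> by (auto simp: b_def)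
  define M where "M c = mat 1 + (c - 1) *\<^sub>R P x" for c
  have M: "M c *v v = v + (c - 1) *\<^sub>R (P x *v v)" for c v
    by (simp add: M_def matrix_vector_mult_add_rdistrib scaleR_matrix_vector_assoc)
  have PM: "P x *v (M c *v v) = c *\<^sub>R (P x *v v)" for c v
    by (simp add: M matrix_vector_right_distrib matrix_vector_mult_scaleR matrix_vector_mul_assoc P
        algebra_simps)
  have norm_M: "(norm (M b *v v))\<^sup>2 = (norm v)\<^sup>2 + (b\<^sup>2 - 1) * (norm (P x *v v))\<^sup>2" for v
  proof -
    have "(norm (M b *v v))\<^sup>2 = (norm (M b *v v - P x *v (M b *v v)))\<^sup>2 + (norm (P x *v (M b *v v)))\<^sup>2"
      by (simp add: norm_sq_sub_projection P)
    also have "M b *v v - P x *v (M b *v v) = v - P x *v v"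
      unfolding PM by (simp add: M algebra_simps)
    finally show ?thesis
      by (simp add: norm_sq_sub_projection P PM power_mult_distrib algebra_simps)
  qed
  have loss: "reg_loss P x \<alpha> (M b *v v) = (1 + \<alpha>) * (norm v)\<^sup>2" for v
  proof -
    have "reg_loss P x \<alpha> (M b *v v) =
        (1 + \<alpha>) * (norm (M b *v v))\<^sup>2 - b\<^sup>2 * (norm (P x *v v))\<^sup>2"
      using norm_sq_sub_projection[OF P, of "M b *v v"] unfolding reg_loss_def
      by (simp add: PM power_mult_distrib distrib_right)
    also have "\<dots> = (1 + \<alpha>) * (norm v)\<^sup>2 + (\<alpha> * b\<^sup>2 - (1 + \<alpha>)) * (norm (P x *v v))\<^sup>2"
      by (simp add: norm_M algebra_simps)
    finally show ?thesis using \<open>b\<^sup>2 = _\<close> \<open>\<alpha> > 0\<close> by simp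
  qed
  have "M b *v v \<in> loss_sublevel P x \<alpha> L \<longleftrightarrow> v \<in> cball 0 (sqrt (L / (1 + \<alpha>)))" for v
  proof -
    have "norm v \<le> sqrt (L / (1 + \<alpha>)) \<longleftrightarrow> (norm v)\<^sup>2 \<le> L / (1 + \<alpha>)"
      using \<open>L \<ge> 0\<close> \<open>\<alpha> > 0\<close>
      by (metis norm_ge_zero real_sqrt_abs abs_of_nonneg real_sqrt_le_iff)
    then show ?thesis
      using \<open>\<alpha> > 0\<close> by (simp add: loss_sublevel_def loss field_simps)
  qed
  \<comment> \<open>\<open>M (1 / b)\<close> is a right inverse of \<open>M b\<close>, so every
    point of the sublevel set has a preimage.\<close>
  moreover have "M b *v (M (1 / b) *v z) = z" for z
    using \<open>b > 0\<close> mult_mat_1_add_scaleR_idempotent[OF P(1), of b "1 / b"]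
    by (simp add: matrix_vector_mul_assoc M_def)
  ultimately have "loss_sublevel P x \<alpha> L = (*v) (M b) ` cball 0 (sqrt (L / (1 + \<alpha>)))"
    by (metis (no_types, lifting) ext image_iff set_eqI)
  then show ?thesis by (simp add: M_def b_def)
qed

lemma measure_loss_sublevel:
  fixes P :: "('a, 'n::finite) regressor"
  assumes P: "P x ** P x = P x" "transpose (P x) = P x" and "\<alpha> > 0" "L \<ge> 0"
  shows "measure lebesgue (loss_sublevel P x \<alpha> L) =
    exp ((ln (1 + \<alpha>) - ln \<alpha>) / 2 * trace (P x)) *
    (unit_ball_vol (CARD('n)) * sqrt (L / (1 + \<alpha>)) ^ CARD('n))"
proof -
  have "(ln (1 + \<alpha>) - ln \<alpha>) / 2 = ln (sqrt ((1 + \<alpha>) / \<alpha>))"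
    using \<open>\<alpha> > 0\<close> by (simp add: ln_sqrt ln_div)
  then have "exp ((ln (1 + \<alpha>) - ln \<alpha>) / 2) = sqrt ((1 + \<alpha>) / \<alpha>)"
    using \<open>\<alpha> > 0\<close> by simp
  then have "det (mat 1 + (sqrt ((1 + \<alpha>) / \<alpha>) - 1) *\<^sub>R P x) =
      exp ((ln (1 + \<alpha>) - ln \<alpha>) / 2 * trace (P x))"
    using det_mat_1_add_scaleR_idempotent[OF P(1)] by metis
  moreover have "measure lebesgue (cball (0 :: real ^ 'n) (sqrt (L / (1 + \<alpha>)))) =
      unit_ball_vol (CARD('n)) * sqrt (L / (1 + \<alpha>)) ^ CARD('n)"
    using \<open>L \<ge> 0\<close> \<open>\<alpha> > 0\<close> by (simp add: measure_completion content_cball)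
  moreover have "linear ((*v) (mat 1 + (sqrt ((1 + \<alpha>) / \<alpha>) - 1) *\<^sub>R P x))"
    by (rule matrix_vector_mul_linear)
  ultimately show ?thesis
    unfolding loss_sublevel_eq_image[where P = P and x = x, OF assms]
    by (simp only: measure_linear_image_finite lmeasurable_cball matrix_of_matrix_vector_mul
        abs_exp_cancel)
qed

section \<open>The supremum over \<open>\<alpha>\<close> and relative entropy\<close>

text \<open>The sign is chosen so that minimizing the log loss rank means maximizing this.\<close>

definition rank_gain :: "real \<Rightarrow> real \<Rightarrow> real \<Rightarrow> real" where
  "rank_gain p q \<alpha> = p * ln (\<alpha> / (1 - q + \<alpha>)) + (1 - p) * ln ((1 + \<alpha>) / (1 - q + \<alpha>))"

text \<open>\<open>ln t \<le> t - 1\<close> is applied to \<open>t = q a / p\<close> and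
  \<open>t = (1 - q) b / (1 - p)\<close>; weighted by \<open>p\<close> and \<open>1 - p\<close>, the
  right-hand sides add up to \<open>q a + (1 - q) b - 1 = 0\<close>.\<close>

lemma rank_gain_le_KL:
  assumes "0 < p" "p < 1" "0 < q" "q < 1" "\<alpha> > 0"
  shows "rank_gain p q \<alpha> \<le> p * ln (p / q) + (1 - p) * ln ((1 - p) / (1 - q))"
proof -
  define L where "L = 1 - q + \<alpha>"
  have "L > 0" using assms by (simp add: L_def)
  have 1: "p * (ln (\<alpha> / L) - ln (p / q)) \<le> q * \<alpha> / L - p"
  proof -
    have "ln (\<alpha> / L) - ln (p / q) = ln (q * \<alpha> / (p * L))"
      using assms \<open>L > 0\<close> by (simp add: ln_div ln_mult)
    also have "\<dots> \<le> q * \<alpha> / (p * L) - 1"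
      using assms \<open>L > 0\<close> by (intro ln_le_minus_one) simp
    finally have "p * (ln (\<alpha> / L) - ln (p / q)) \<le> p * (q * \<alpha> / (p * L) - 1)"
      using assms by (intro mult_left_mono) auto
    also have "\<dots> = q * \<alpha> / L - p" using assms by (simp add: right_diff_distrib)
    finally show ?thesis .
  qed
  have 2: "(1 - p) * (ln ((1 + \<alpha>) / L) - ln ((1 - p) / (1 - q))) \<le> (1 - q) * (1 + \<alpha>) / L - (1 - p)"
  proof -
    have "ln ((1 + \<alpha>) / L) - ln ((1 - p) / (1 - q)) = ln ((1 - q) * (1 + \<alpha>) / ((1 - p) * L))"
      using assms \<open>L > 0\<close> by (simp add: ln_div ln_mult)
    also have "\<dots> \<le> (1 - q) * (1 + \<alpha>) / ((1 - p) * L) - 1"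
      using assms \<open>L > 0\<close> by (intro ln_le_minus_one) simp
    finally have "(1 - p) * (ln ((1 + \<alpha>) / L) - ln ((1 - p) / (1 - q))) \<le>
        (1 - p) * ((1 - q) * (1 + \<alpha>) / ((1 - p) * L) - 1)"
      using assms by (intro mult_left_mono) auto
    also have "\<dots> = (1 - q) * (1 + \<alpha>) / L - (1 - p)"
      using assms by (simp add: right_diff_distrib)
    finally show ?thesis .
  qed
  have "q * \<alpha> / L + (1 - q) * (1 + \<alpha>) / L = 1"
    using \<open>L > 0\<close> by (simp add: L_def algebra_simps flip: add_divide_distrib)
  then show ?thesis
    using 1 2 by (simp add: rank_gain_def L_def algebra_simps)
qed

text \<open>Replacing the weights \<open>p, 1 - p\<close> by \<open>q, 1 - q\<close> costs
  \<open>(p - q) (ln a - ln b)\<close>, which is at most 0 because \<open>a \<le> b\<close>. The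
  rest is bounded through \<open>ln t \<le> t - 1\<close> by
  \<open>q a + (1 - q) b - 1 = 0\<close>.\<close>

lemma rank_gain_le_0:
  assumes "q \<le> p" "0 \<le> q" "q \<le> 1" "\<alpha> > 0"
  shows "rank_gain p q \<alpha> \<le> 0"
proof -
  define L where "L = 1 - q + \<alpha>"
  have "L > 0" using assms by (simp add: L_def)
  define a b where "a = \<alpha> / L" and "b = (1 + \<alpha>) / L"
  have "0 < a" "a \<le> b" using \<open>L > 0\<close> assms by (auto simp: a_def b_def divide_right_mono)
  have ab: "q * a + (1 - q) * b = 1"
    using \<open>L > 0\<close> by (simp add: a_def b_def L_def algebra_simps flip: add_divide_distrib)
  have "p * ln a + (1 - p) * ln b = q * ln a + (1 - q) * ln b + (p - q) * (ln a - ln b)"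
    by (simp add: algebra_simps)
  also have "\<dots> \<le> q * (a - 1) + (1 - q) * (b - 1) + 0"
    using assms \<open>0 < a\<close> \<open>a \<le> b\<close>
    by (intro add_mono mult_left_mono ln_le_minus_one mult_nonneg_nonpos) auto
  also have "\<dots> = 0" using ab by (simp add: algebra_simps)
  finally show ?thesis by (simp add: rank_gain_def a_def b_def L_def)
qed

lemma rank_gain_tendsto_0: "((\<lambda>\<alpha>. rank_gain p q \<alpha>) \<longlongrightarrow> 0) at_top"
proof -
  have "((\<lambda>\<alpha>::real. \<alpha> / (1 - q + \<alpha>)) \<longlongrightarrow> 1) at_top" "((\<lambda>\<alpha>::real. (1 + \<alpha>) / (1 - q + \<alpha>)) \<longlongrightarrow> 1) at_top"
    by real_asymp+
  then have "((\<lambda>\<alpha>. rank_gain p q \<alpha>) \<longlongrightarrow> p * ln 1 + (1 - p) * ln 1) at_top"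
    unfolding rank_gain_def by (intro tendsto_intros) auto
  then show ?thesis by simp
qed

text \<open>For \<open>q = 1\<close> the first logarithm is \<open>ln 1\<close>, while the second
  diverges and has the positive weight \<open>1 - p\<close>.\<close>

lemma rank_gain_at_top:
  assumes "p < 1"
  shows "filterlim (rank_gain p 1) at_top (at_right 0)"
  using assms unfolding rank_gain_def by real_asymp

lemma rank_gain_optimal:
  assumes "0 < p" "p < q" "q < 1"
  shows "rank_gain p q (p * (1 - q) / (q - p)) = p * ln (p / q) + (1 - p) * ln ((1 - p) / (1 - q))"
proof -
  define \<alpha> where "\<alpha> = p * (1 - q) / (q - p)"
  have "1 - q + \<alpha> = q * (1 - q) / (q - p)" "1 + \<alpha> = q * (1 - p) / (q - p)"
    using assms by (auto simp: \<alpha>_def field_simps)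
  then have "\<alpha> / (1 - q + \<alpha>) = p / q" "(1 + \<alpha>) / (1 - q + \<alpha>) = (1 - p) / (1 - q)"
    using assms by (auto simp: \<alpha>_def)
  then show ?thesis by (simp add: rank_gain_def flip: \<alpha>_def)
qed

text \<open>\<open>ln t \<le> t - 1\<close> is strict at \<open>t = q / p\<close>, as
  \<open>p \<noteq> q\<close>; the linear bounds \<open>q - p\<close> and \<open>p - q\<close> of
  the two terms cancel.\<close>

lemma KL_pos:
  assumes "0 < p" "p < q" "q \<le> 1"
  shows "KL p q > 0"
proof (cases "q = 1")
  case True
  then show ?thesis using assms by (simp add: KL_def kl_term_def)
next
  case False
  have "ln (q / p) \<noteq> q / p - 1" using ln_eq_minus_one[of "q / p"] assms by auto
  then have "ln (q / p) < q / p - 1" using ln_le_minus_one[of "q / p"] assms by simp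
  then have "p * ln (q / p) < q - p" using assms by (simp add: field_simps)
  moreover have "ln ((1 - q) / (1 - p)) \<le> (1 - q) / (1 - p) - 1"
    using assms False by (intro ln_le_minus_one) auto
  then have "(1 - p) * ln ((1 - q) / (1 - p)) \<le> p - q" using assms by (simp add: field_simps)
  ultimately show ?thesis
    using assms False by (simp add: KL_def kl_term_def ln_div algebra_simps)
qed

text \<open>The first hypothesis keeps the maximizer \<open>p (1 - q) / (q - p)\<close> positive
  when \<open>p < q < 1\<close>; for \<open>p = 0\<close> it would be 0, outside the range of
  \<open>\<alpha>\<close>.\<close>

lemma SUP_rank_gain:
  assumes "0 < p \<or> q \<le> p" "0 \<le> q" "q \<le> 1"
  shows "(SUP \<alpha>\<in>{0<..}. ereal (rank_gain p q \<alpha>)) = (if p < q then KL p q else 0)"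
proof -
  consider "q \<le> p" | "p < q" "q < 1" | "p < q" "q = 1" using assms by linarith
  then show ?thesis
  proof cases
    case 1
    have "(SUP \<alpha>\<in>{0<..}. ereal (rank_gain p q \<alpha>)) = 0"
    proof (intro antisym SUP_least)
      show "0 \<le> (SUP \<alpha>\<in>{0<..}. ereal (rank_gain p q \<alpha>))"
      proof (rule tendsto_upperbound)
        show "((\<lambda>\<alpha>. ereal (rank_gain p q \<alpha>)) \<longlongrightarrow> 0) at_top"
          using rank_gain_tendsto_0[of p q] by (simp add: zero_ereal_def)
        show "\<forall>\<^sub>F \<alpha> in at_top. ereal (rank_gain p q \<alpha>) \<le> (SUP \<alpha>\<in>{0<..}. ereal (rank_gain p q \<alpha>))"
          using eventually_gt_at_top[of 0] by eventually_elim (auto intro: SUP_upper)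
      qed simp
    qed (use rank_gain_le_0 1 assms in auto)
    with 1 show ?thesis by simp
  next
    case 2
    then have "p * (1 - q) / (q - p) > 0" using assms by simp
    then have "(SUP \<alpha>\<in>{0<..}. ereal (rank_gain p q \<alpha>)) =
        ereal (p * ln (p / q) + (1 - p) * ln ((1 - p) / (1 - q)))"
      using 2 assms rank_gain_le_KL
      by (intro antisym SUP_least SUP_upper2[of "p * (1 - q) / (q - p)"])
         (auto simp: rank_gain_optimal)
    with 2 assms show ?thesis by (simp add: KL_def kl_term_def)
  next
    case 3
    have "(SUP \<alpha>\<in>{0<..}. ereal (rank_gain p q \<alpha>)) = \<infinity>"
    proof (rule SUP_PInfty)
      fix n :: nat
      have "\<forall>\<^sub>F \<alpha> in at_right 0. real n \<le> rank_gain p 1 \<alpha>"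
        using rank_gain_at_top[of p] 3 by (auto simp: filterlim_at_top)
      then have "\<forall>\<^sub>F \<alpha> in at_right 0. real n \<le> rank_gain p 1 \<alpha> \<and> \<alpha> > 0"
        using eventually_at_right_less by (rule eventually_conj)
      then obtain \<alpha> where "real n \<le> rank_gain p 1 \<alpha>" "\<alpha> > 0"
        using eventually_happens trivial_limit_at_right_real by blast
      then show "\<exists>i\<in>{0<..}. ereal (real n) \<le> ereal (rank_gain p q i)"
        using 3 by auto
    qed
    with 3 assms show ?thesis by (simp add: KL_def kl_term_def)
  qed
qed

section \<open>The log loss rank in terms of trace and fit ratio\<close>

text \<open>The fit ratio is the squared norm of \<open>P x *v y\<close> relative to that of
  \<open>y\<close>.\<close>

lemma fit_ratio_bounds:
  fixes P :: "('a, 'n::finite) regressor"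
  assumes "P x ** P x = P x" "transpose (P x) = P x" "y \<noteq> 0"
  shows "0 \<le> fit_ratio P x y" "fit_ratio P x y \<le> 1"
proof -
  have "(norm (P x *v y))\<^sup>2 \<le> (norm y)\<^sup>2"
    using norm_sq_sub_projection[OF assms(1,2), of y] by (metis diff_ge_0_iff_ge zero_le_power2)
  then show "0 \<le> fit_ratio P x y" "fit_ratio P x y \<le> 1"
    using assms by (simp_all add: fit_ratio_def inner_projection_self power2_norm_eq_inner)
qed

lemma reg_loss_eq_fit_ratio:
  fixes P :: "('a, 'n::finite) regressor"
  assumes "P x ** P x = P x" "transpose (P x) = P x" "y \<noteq> 0"
  shows "reg_loss P x \<alpha> y = (norm y)\<^sup>2 * (1 - fit_ratio P x y + \<alpha>)"
  using assms
  by (simp add: reg_loss_def norm_sq_sub_projection fit_ratio_def inner_projection_self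
      flip: power2_norm_eq_inner) (simp add: field_simps)

lemma log_loss_rank_eq_rank_gain:
  fixes P :: "('a, 'n::finite) regressor"
  assumes P: "P x ** P x = P x" "transpose (P x) = P x" and "y \<noteq> 0" "\<alpha> > 0"
  shows "log_loss_rank P x \<alpha> y = ln (unit_ball_vol (CARD('n))) + CARD('n) / 2 * ln ((norm y)\<^sup>2)
    - CARD('n) / 2 * rank_gain (trace_ratio P x) (fit_ratio P x y) \<alpha>"
proof -
  define q where "q = fit_ratio P x y"
  have "1 - q + \<alpha> > 0"
    using fit_ratio_bounds[where P = P and x = x, OF P \<open>y \<noteq> 0\<close>] \<open>\<alpha> > 0\<close> by (simp add: q_def)
  have trace: "trace (P x) = CARD('n) * trace_ratio P x" by (simp add: trace_ratio_def)
  \<comment> \<open>To be used with \<open>u\<close> the unit ball volume and \<open>v\<close> the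
    squared radius, which is positive since \<open>y \<noteq> 0\<close> and
    \<open>\<alpha> > 0\<close>.\<close>
  have ln_vol: "ln (exp s * (u * sqrt v ^ n)) = s + ln u + n / 2 * ln v"
    if "u > 0" "v > 0" for s u v :: real and n
    using that by (simp add: ln_mult ln_realpow ln_sqrt)
  have "log_loss_rank P x \<alpha> y = (ln (1 + \<alpha>) - ln \<alpha>) / 2 * trace (P x)
      + ln (unit_ball_vol (CARD('n))) + CARD('n) / 2 * ln ((norm y)\<^sup>2 * (1 - q + \<alpha>) / (1 + \<alpha>))"
    unfolding log_loss_rank_def reg_loss_eq_fit_ratio[where P = P and x = x, OF P \<open>y \<noteq> 0\<close>] q_def[symmetric]
    using \<open>1 - q + \<alpha> > 0\<close> \<open>\<alpha> > 0\<close> \<open>y \<noteq> 0\<close>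
    by (subst measure_loss_sublevel[where P = P and x = x, OF P]; (subst ln_vol)?) auto
  also have "ln ((norm y)\<^sup>2 * (1 - q + \<alpha>) / (1 + \<alpha>)) =
      ln ((norm y)\<^sup>2) + ln (1 - q + \<alpha>) - ln (1 + \<alpha>)"
    using \<open>1 - q + \<alpha> > 0\<close> \<open>\<alpha> > 0\<close> \<open>y \<noteq> 0\<close> by (simp add: ln_div ln_mult)
  finally show ?thesis
    unfolding rank_gain_def trace q_def[symmetric]
    using \<open>1 - q + \<alpha> > 0\<close> \<open>\<alpha> > 0\<close> by (simp add: ln_div field_simps)
qed

section \<open>Minimization over \<open>\<alpha>\<close> in the extended reals\<close>

lemma SUP_ereal_cmult_le:
  fixes d :: real
  assumes "d > 0"
  shows "(SUP i\<in>I. ereal (d * g i)) \<le> ereal d * (SUP i\<in>I. ereal (g i))"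
proof (rule SUP_least)
  fix i assume "i \<in> I"
  then have "ereal d * ereal (g i) \<le> ereal d * (SUP i\<in>I. ereal (g i))"
    using assms by (intro ereal_mult_left_mono SUP_upper) auto
  then show "ereal (d * g i) \<le> ereal d * (SUP i\<in>I. ereal (g i))" by simp
qed

text \<open>The reverse inequality is the previous one for the factor \<open>1 / d\<close>,
  multiplied by \<open>d\<close>.\<close>

lemma SUP_ereal_cmult:
  fixes d :: real
  assumes "d > 0"
  shows "(SUP i\<in>I. ereal (d * g i)) = ereal d * (SUP i\<in>I. ereal (g i))"
proof (rule antisym[OF SUP_ereal_cmult_le[OF assms]])
  have "(SUP i\<in>I. ereal (g i)) = (SUP i\<in>I. ereal (1 / d * (d * g i)))"
    using assms by simp
  also have "\<dots> \<le> ereal (1 / d) * (SUP i\<in>I. ereal (d * g i))"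
    using assms by (intro SUP_ereal_cmult_le) simp
  finally have "ereal d * (SUP i\<in>I. ereal (g i)) \<le> ereal d * (ereal (1 / d) * (SUP i\<in>I. ereal (d * g i)))"
    using assms by (intro ereal_mult_left_mono) auto
  also have "\<dots> = (SUP i\<in>I. ereal (d * g i))"
    using assms by (simp flip: mult.assoc add: one_ereal_def[symmetric])
  finally show "ereal d * (SUP i\<in>I. ereal (g i)) \<le> (SUP i\<in>I. ereal (d * g i))" .
qed

text \<open>Provides the hypothesis of \<open>SUP_rank_gain\<close>: a symmetric idempotent of trace
  0 is 0, and then the fit ratio vanishes too.\<close>

lemma trace_ratio_pos_or_fit_le:
  fixes P :: "('a, 'n::finite) regressor"
  assumes "P x ** P x = P x" "transpose (P x) = P x"
  shows "0 < trace_ratio P x \<or> fit_ratio P x y \<le> trace_ratio P x"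
proof (cases "trace (P x) = 0")
  case True
  then show ?thesis
    using trace_projection_eq_0_imp[OF assms] by (simp add: fit_ratio_def trace_ratio_def)
next
  case False
  then show ?thesis
    using trace_projection_nonneg[OF assms] by (simp add: trace_ratio_def)
qed

lemma min_log_loss_rank_eq_KL:
  fixes P :: "('a, 'n::finite) regressor"
  assumes P: "P x ** P x = P x" "transpose (P x) = P x" and "y \<noteq> 0"
  shows "min_log_loss_rank P x y =
    ereal (ln (unit_ball_vol (CARD('n))) + CARD('n) / 2 * ln ((norm y)\<^sup>2)) - ereal (CARD('n) / 2) *
      (if trace_ratio P x < fit_ratio P x y then KL (trace_ratio P x) (fit_ratio P x y) else 0)"
    (is "_ = ereal ?c - ereal ?d * _")
proof -
  have "min_log_loss_rank P x y = (INF \<alpha>\<in>{0<..}.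
      ereal ?c - ereal (?d * rank_gain (trace_ratio P x) (fit_ratio P x y) \<alpha>))"
    unfolding min_log_loss_rank_def
    by (intro INF_cong refl) (simp add: log_loss_rank_eq_rank_gain[where P = P and x = x, OF P \<open>y \<noteq> 0\<close>])
  also have "\<dots> = ereal ?c - ereal ?d *
      (SUP \<alpha>\<in>{0<..}. ereal (rank_gain (trace_ratio P x) (fit_ratio P x y) \<alpha>))"
    by (subst INF_ereal_minus_right; (subst SUP_ereal_cmult)?) auto
  also note SUP_rank_gain[OF trace_ratio_pos_or_fit_le[where P = P and x = x, OF P] fit_ratio_bounds[where P = P and x = x, OF P \<open>y \<noteq> 0\<close>]]
  finally show ?thesis .
qed

lemma ereal_affine_less_iff:
  fixes u v :: ereal and c d :: real
  assumes "d > 0"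
  shows "ereal c - ereal d * u < ereal c - ereal d * v \<longleftrightarrow> v < u"
  using assms by (cases u; cases v) auto

section \<open>Comparison of regressors\<close>

theorem theorem11:
  fixes x :: "'a ^ 'n::finite" and y :: "real ^ 'n"
    and \<P> :: "('a, 'n) regressor set" and P :: "('a, 'n) regressor"
  assumes "y \<noteq> 0"
    and "\<And>Q. Q \<in> \<P> \<Longrightarrow> projective_regressor Q"
    and "\<And>Q. Q \<in> \<P> \<Longrightarrow> transpose (Q x) = Q x"
    and "\<exists>Q\<in>\<P>. trace_ratio Q x < fit_ratio Q x y"
  shows "lorp_best \<P> x y P \<longleftrightarrow>
    is_arg_max (\<lambda>Q. KL (trace_ratio Q x) (fit_ratio Q x y))
      (\<lambda>Q. Q \<in> \<P> \<and> trace_ratio Q x < fit_ratio Q x y) P"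
proof -
  define ok where "ok Q \<longleftrightarrow> trace_ratio Q x < fit_ratio Q x y" for Q
  define kl where "kl Q = KL (trace_ratio Q x) (fit_ratio Q x y)" for Q
  have proj: "Q x ** Q x = Q x" "transpose (Q x) = Q x" if "Q \<in> \<P>" for Q
    using assms(2,3)[OF that] by (auto simp: projective_regressor_def)
  \<comment> \<open>Comparing minimal ranks reverses the comparison of entropies, with value 0 for
    regressors that violate the proviso.\<close>
  have less_iff: "min_log_loss_rank Q x y < min_log_loss_rank R x y \<longleftrightarrow>
      (if ok R then kl R else 0) < (if ok Q then kl Q else 0)" if "Q \<in> \<P>" "R \<in> \<P>" for Q R
    unfolding ok_def kl_def using that
    by (simp only: min_log_loss_rank_eq_KL[where P = Q and x = x, OF proj[OF that(1)] \<open>y \<noteq> 0\<close>]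
        min_log_loss_rank_eq_KL[where P = R and x = x, OF proj[OF that(2)] \<open>y \<noteq> 0\<close>])
       (intro ereal_affine_less_iff, simp)
  have pos: "0 < kl Q" if "Q \<in> \<P>" "ok Q" for Q
    using that trace_ratio_pos_or_fit_le[where P = Q and x = x, OF proj[OF that(1)], of y]
      fit_ratio_bounds[where P = Q and x = x, OF proj[OF that(1)] \<open>y \<noteq> 0\<close>]
    by (auto simp: kl_def ok_def intro: KL_pos)
  obtain Q0 where "Q0 \<in> \<P>" "ok Q0" using assms(4) by (auto simp: ok_def)
  have "lorp_best \<P> x y P \<longleftrightarrow> P \<in> \<P> \<and>
      (\<forall>Q\<in>\<P>. \<not> (if ok P then kl P else 0) < (if ok Q then kl Q else 0))"
    unfolding lorp_best_def is_arg_min_def using less_iff by blast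
  \<comment> \<open>A regressor violating the proviso loses to \<open>Q0\<close>, whose value is
    positive. Conversely, a maximizer among the admissible ones has a positive value and so is not
    beaten by the value 0 of the others.\<close>
  also have "\<dots> \<longleftrightarrow> P \<in> \<P> \<and> ok P \<and> (\<forall>Q\<in>\<P>. ok Q \<longrightarrow> \<not> kl P < kl Q)"
    using pos \<open>Q0 \<in> \<P>\<close> \<open>ok Q0\<close> by (smt (verit, best) order.asym)
  also have "\<dots> \<longleftrightarrow> is_arg_max kl (\<lambda>Q. Q \<in> \<P> \<and> ok Q) P"
    unfolding is_arg_max_def by blast
  finally show ?thesis unfolding ok_def kl_def .
qed

end
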